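(* (Bilinearization and Casoratian solutions of C3$_{b_0}$.) Let $\alpha_2,p,q,a,b\in\mathbb C$ with $p,q,a,b$ pairwise distinct, and put $$P=p^3-\alpha_2p^2-a^3+\alpha_2a^2,\quad Q=q^3-\alpha_2q^2-a^3+\alpha_2a^2,\quad b_0=a^3-\alpha_2a^2-b^3+\alpha_2b^2,$$ $$p_a=\frac{P}{p-a},\qquad q_a=\frac{Q}{q-a},\qquad a_b=a^2+ab+b^2-\alpha_2(a+b),$$ $$x_{a,b}=\frac1{b-a}\left(\frac{p-b}{p-a}\right)^n\left(\frac{q-b}{q-a}\right)^m,\quad z_b=(p-b)^n(q-b)^m,\quad y_a=-(p-a)^{-n}(q-a)^{-m}.$$ Consider the bilinear equations for a function $f$ of $(n,m,\alpha,\beta)\in\mathbb Z^4$: $$(p-b)\widetilde{\underline f}{}^{\bullet}f-(p-a)\underline f^{\bullet}\,\widetilde f+(b-a)f^\bullet\,\widetilde{\underline f}=0,$$ $$(q-b)\widehat{\underline f}{}^{\bullet}f-(q-a)\underline f^{\bullet}\,\widehat f+(b-a)f^\bullet\,\widehat{\underline f}=0,$$ $$(p-b)\widehat f\,\widetilde f^{\bullet}-(q-b)\widetilde f\,\widehat f^{\bullet}-(p-q)\widehat{\widetilde f}\,f^\bullet=0,$$ $$(p-q)\widehat{\widetilde f}{}^{\bullet}\underline f-\frac{(p-q)a_b}{(p-b)(q-b)}\widehat{\widetilde f}\,\underline f^{\bullet}-\frac{p_a}{p-b}\widehat f^{\bullet}\,\widetilde{\underline f}+\frac{q_a}{q-b}\widetilde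 f^{\bullet}\,\widehat{\underline f}=0.$$ (i) If $f:\mathbb Z^4\to\mathbb C$ satisfies these equations and vanishes nowhere, then for each fixed $(\alpha,\beta)$ the functions $$x=x_{a,b}\frac{\underline f^{\bullet}}f,\qquad z=z_b\frac{f^\bullet}f,\qquad y=y_a\frac{\underline f}f$$ of $(n,m)$ satisfy the C3$_{b_0}$ lattice system $$\widetilde x-\widetilde y\,z-x=0,\qquad\widehat x-\widehat y\,z-x=0,\qquad\widehat{\widetilde z}\,y-b_0x-z\,\frac{P\,\widetilde y\,\widehat z-Q\,\widehat y\,\widetilde z}{\widetilde z-\widehat z}=0 .$$ (ii) The bilinear equations are satisfied by the Casoratian $f=|0,1,\dots,N-1|$, for every $N\ge1$, with entries $$\psi_j(l)=\sum_{s=0}^2(\delta-\omega_s(k_j))^l(p-\omega_s(k_j))^n(q-\omega_s(k_j))^m(a-\omega_s(k_j))^\alpha(b-\omega_s(k_j))^\beta\varrho_{j,s}^{(0)},\qquad j=1,\dots,N,$$ where $\delta,k_j,\varrho_{j,s}^{(0)}\in\mathbb C$ are arbitrary constants such that none of $p,q,a,b$ equals any $\omega_s(k_j)$, and $\omega_0(k)=k$, $\omega_1(k)$, $\omega_2(k)$ are the three roots $\omega$ of $\omega^3-\alpha_2\omega^2=k^3-\alpha_2k^2$.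
   Context: For a function $u$ of $(n,m,\alpha,\beta)$: $\widetilde u$ is the shift $n\to n+1$, $\widehat u$ the shift $m\to m+1$, $\underline u$ the shift $\alpha\to\alpha-1$, $u^\bullet$ the shift $\beta\to\beta+1$; combined decorations denote combined shifts (for example $\widetilde{\underline f}{}^\bullet=f(n+1,m,\alpha-1,\beta+1)$). For a column vector $\psi(l)=(\psi_1(l),\dots,\psi_N(l))^T$, the Casoratian $|l_1,\dots,l_N|$ is the $N\times N$ determinant $\det(\psi(l_1),\dots,\psi(l_N))$. *)

theory Defs
  imports
    Complex_Main
    "HOL-Library.Multiset"
    "HOL-Computational_Algebra.Polynomial"
    "Jordan_Normal_Form.Determinant"
begin

(* The common shape of the constants P = cub p a, Q = cub q a and b_0 = cub a b. *)
definition cub :: "complex \<Rightarrow> complex \<Rightarrow> complex \<Rightarrow> complex" where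
  "cub \<alpha>\<^sub>2 u v = u^3 - \<alpha>\<^sub>2 * u^2 - v^3 + \<alpha>\<^sub>2 * v^2"

(* p_a = cub_quot p a and q_a = cub_quot q a *)
definition cub_quot :: "complex \<Rightarrow> complex \<Rightarrow> complex \<Rightarrow> complex" where
  "cub_quot \<alpha>\<^sub>2 u a = cub \<alpha>\<^sub>2 u a / (u - a)"

definition a_b :: "complex \<Rightarrow> complex \<Rightarrow> complex \<Rightarrow> complex" where
  "a_b \<alpha>\<^sub>2 a b = a^2 + a * b + b^2 - \<alpha>\<^sub>2 * (a + b)"

definition x_ab :: "complex \<Rightarrow> complex \<Rightarrow> complex \<Rightarrow> complex \<Rightarrow> int \<Rightarrow> int \<Rightarrow> complex" where
  "x_ab p q a b n m = 1 / (b - a) * ((p - b) / (p - a)) powi n * ((q - b) / (q - a)) powi m"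

definition z_b :: "complex \<Rightarrow> complex \<Rightarrow> complex \<Rightarrow> int \<Rightarrow> int \<Rightarrow> complex" where
  "z_b p q b n m = (p - b) powi n * (q - b) powi m"

definition y_a :: "complex \<Rightarrow> complex \<Rightarrow> complex \<Rightarrow> int \<Rightarrow> int \<Rightarrow> complex" where
  "y_a p q a n m = - ((p - a) powi (- n) * (q - a) powi (- m))"

(* The arguments of f are n, m, \<alpha>, \<beta>; tilde, hat, underline and bullet are n + 1, m + 1,
   \<alpha> - 1 and \<beta> + 1, respectively. *)
definition bilinear_C3 ::
  "complex \<Rightarrow> complex \<Rightarrow> complex \<Rightarrow> complex \<Rightarrow> complex
    \<Rightarrow> (int \<Rightarrow> int \<Rightarrow> int \<Rightarrow> int \<Rightarrow> complex) \<Rightarrow> bool" where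
  "bilinear_C3 \<alpha>\<^sub>2 p q a b f \<longleftrightarrow> (\<forall>n m \<alpha> \<beta>.
     (p - b) * f (n+1) m (\<alpha>-1) (\<beta>+1) * f n m \<alpha> \<beta>
       - (p - a) * f n m (\<alpha>-1) (\<beta>+1) * f (n+1) m \<alpha> \<beta>
       + (b - a) * f n m \<alpha> (\<beta>+1) * f (n+1) m (\<alpha>-1) \<beta> = 0 \<and>
     (q - b) * f n (m+1) (\<alpha>-1) (\<beta>+1) * f n m \<alpha> \<beta>
       - (q - a) * f n m (\<alpha>-1) (\<beta>+1) * f n (m+1) \<alpha> \<beta>
       + (b - a) * f n m \<alpha> (\<beta>+1) * f n (m+1) (\<alpha>-1) \<beta> = 0 \<and>
     (p - b) * f n (m+1) \<alpha> \<beta> * f (n+1) m \<alpha> (\<beta>+1)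
       - (q - b) * f (n+1) m \<alpha> \<beta> * f n (m+1) \<alpha> (\<beta>+1)
       - (p - q) * f (n+1) (m+1) \<alpha> \<beta> * f n m \<alpha> (\<beta>+1) = 0 \<and>
     (p - q) * f (n+1) (m+1) \<alpha> (\<beta>+1) * f n m (\<alpha>-1) \<beta>
       - (p - q) * a_b \<alpha>\<^sub>2 a b / ((p - b) * (q - b))
           * f (n+1) (m+1) \<alpha> \<beta> * f n m (\<alpha>-1) (\<beta>+1)
       - cub_quot \<alpha>\<^sub>2 p a / (p - b) * f n (m+1) \<alpha> (\<beta>+1) * f (n+1) m (\<alpha>-1) \<beta>
       + cub_quot \<alpha>\<^sub>2 q a / (q - b) * f (n+1) m \<alpha> (\<beta>+1) * f n (m+1) (\<alpha>-1) \<beta> = 0)"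

(* The first conjunct is the well-definedness of the fraction in the last equation; without it
   the convention u / 0 = 0 would give that equation an unintended meaning. *)
definition C3_system ::
  "complex \<Rightarrow> complex \<Rightarrow> complex \<Rightarrow> (int \<Rightarrow> int \<Rightarrow> complex) \<Rightarrow> (int \<Rightarrow> int \<Rightarrow> complex)
    \<Rightarrow> (int \<Rightarrow> int \<Rightarrow> complex) \<Rightarrow> bool" where
  "C3_system P Q b\<^sub>0 x y z \<longleftrightarrow> (\<forall>n m.
     z (n+1) m - z n (m+1) \<noteq> 0 \<and>
     x (n+1) m - y (n+1) m * z n m - x n m = 0 \<and>
     x n (m+1) - y n (m+1) * z n m - x n m = 0 \<and>
     z (n+1) (m+1) * y n m - b\<^sub>0 * x n m
       - z n m * ((P * y (n+1) m * z n (m+1) - Q * y n (m+1) * z (n+1) m)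
                   / (z (n+1) m - z n (m+1))) = 0)"

definition casoratian :: "(nat \<Rightarrow> complex vec) \<Rightarrow> nat list \<Rightarrow> complex" where
  "casoratian \<psi> ls = det (mat_of_cols (length ls) (map \<psi> ls))"

(* \<omega> 0 k, \<omega> 1 k, \<omega> 2 k are the roots of X^3 - \<alpha>\<^sub>2 X^2 = k^3 - \<alpha>\<^sub>2 k^2, with multiplicity. *)
definition root_triple :: "complex \<Rightarrow> (nat \<Rightarrow> complex \<Rightarrow> complex) \<Rightarrow> bool" where
  "root_triple \<alpha>\<^sub>2 \<omega> \<longleftrightarrow> (\<forall>k. \<omega> 0 k = k \<and>
     proots [: - (k^3 - \<alpha>\<^sub>2 * k^2), 0, - \<alpha>\<^sub>2, 1 :] = {# \<omega> 0 k, \<omega> 1 k, \<omega> 2 k #})"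

(* The column vector psi(l); its components are numbered from 0. *)
definition psi_vec ::
  "complex \<Rightarrow> complex \<Rightarrow> complex \<Rightarrow> complex \<Rightarrow> (nat \<Rightarrow> complex \<Rightarrow> complex) \<Rightarrow> nat \<Rightarrow> complex
    \<Rightarrow> (nat \<Rightarrow> complex) \<Rightarrow> (nat \<Rightarrow> nat \<Rightarrow> complex) \<Rightarrow> int \<Rightarrow> int \<Rightarrow> int \<Rightarrow> int
    \<Rightarrow> nat \<Rightarrow> complex vec" where
  "psi_vec p q a b \<omega> N \<delta> k \<rho> n m \<alpha> \<beta> l = vec N (\<lambda>j. \<Sum>s = 0..2.
     (\<delta> - \<omega> s (k j)) ^ l * (p - \<omega> s (k j)) powi n * (q - \<omega> s (k j)) powi m
       * (a - \<omega> s (k j)) powi \<alpha> * (b - \<omega> s (k j)) powi \<beta> * \<rho> j s)"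

end

(* Write t = delta - omega. The Casoratian is the determinant of N linear functionals V_j on
   polynomials in t, applied to 1, t, ..., t^(N-1), and each shift of n, m, alpha or beta multiplies
   the argument of the V_j by a factor t - x, with x = delta - p, and so on. Adjoining evaluations at
   points x_1, ..., x_r as further rows to the V_j gives the r-fold shifted Casoratian times a
   Vandermonde determinant in the x_i. Let u be the polynomial of degree at most N whose coefficients
   are the cofactors of an extra row, so that V_j(u) = 0, u(x) is the Casoratian shifted by x, and its
   top coefficient is the unshifted one up to sign. If h has degree less than r and each V_j turns
   multiplication by h into a scalar, then h u is annihilated by the V_j as well, and Cramer's rule for
   its top coefficient is a bilinear identity. The first three equations are the case h = 1, r = 3, and
   the last one is the case of the cubic h vanishing at a, r = 4.
   Part (i) is a direct substitution. *)
theory Submission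
  imports Defs
begin

section \<open>Determinants of moment sequences of linear functionals\<close>

text \<open>A row of a matrix is the sequence of moments \<open>L(t^j)\<close> of a linear functional \<open>L\<close> on polynomials.
  Composing \<open>L\<close> with the multiplication by \<open>t - x\<close> gives \<open>times_linear\<close>.\<close>

definition moment_det :: "(nat \<Rightarrow> 'a::comm_ring_1) list \<Rightarrow> 'a" where
  "moment_det rs = det (mat (length rs) (length rs) (\<lambda>(i, j). (rs ! i) j))"

definition eval_moments :: "'a::comm_ring_1 \<Rightarrow> nat \<Rightarrow> 'a" where
  "eval_moments x j = x ^ j"

definition times_linear :: "'a::comm_ring_1 \<Rightarrow> (nat \<Rightarrow> 'a) \<Rightarrow> nat \<Rightarrow> 'a" where
  "times_linear x r j = r (Suc j) - x * r j"

text \<open>Laplace expansion along the first row: its cofactors do not involve that row, so one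
  \<open>u\<close> serves every \<open>r\<close>. Deleting the first row and the last column leaves
  the matrix of \<open>rs\<close>, whence the top coefficient.\<close>

lemma moment_det_Cons_linear:
  fixes rs :: "(nat \<Rightarrow> 'a::comm_ring_1) list"
  obtains u where "\<And>r. moment_det (r # rs) = (\<Sum>j\<le>length rs. r j * u j)"
    and "u (length rs) = (-1) ^ length rs * moment_det rs"
proof
  define n where "n = length rs"
  let ?M = "\<lambda>r. mat (Suc n) (Suc n) (\<lambda>(i, j). ((r # rs) ! i) j)"
  \<comment> \<open>The zero row is a placeholder that makes the choice of \<open>u\<close> visibly
    independent of \<open>r\<close>.\<close>
  let ?u = "\<lambda>j. cofactor (?M (\<lambda>_. 0)) 0 j"
  have del: "mat_delete (?M r) 0 j = mat_delete (?M (\<lambda>_. 0)) 0 j" for r j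
    by (rule eq_matI) (auto simp: mat_delete_def)
  show "moment_det (r # rs) = (\<Sum>j\<le>length rs. r j * ?u j)" for r
  proof -
    have "moment_det (r # rs) = (\<Sum>j<Suc n. ?M r $$ (0, j) * cofactor (?M r) 0 j)"
      unfolding moment_det_def n_def by (simp add: laplace_expansion_row[where i = 0 and n = "Suc (length rs)"])
    also have "\<dots> = (\<Sum>j\<le>length rs. r j * ?u j)"
      unfolding lessThan_Suc_atMost n_def[symmetric]
      by (rule sum.cong) (auto simp: cofactor_def del[of r])
    finally show ?thesis .
  qed
  have "mat_delete (?M (\<lambda>_. 0)) 0 n = mat n n (\<lambda>(i, j). (rs ! i) j)"
    by (rule eq_matI) (auto simp: mat_delete_def)
  then show "?u (length rs) = (-1) ^ length rs * moment_det rs"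
    by (simp add: cofactor_def moment_det_def n_def)
qed

text \<open>A repeated row gives determinant zero. Read with the cofactor polynomial
  \<open>u\<close>, every functional in \<open>rs\<close> annihilates \<open>u\<close>; the factor
  \<open>c\<close> will be the scalar by which a multiplier acts on the row.\<close>

lemma moment_det_Cons_member:
  assumes "r \<in> set rs"
  shows "moment_det ((\<lambda>j. c * r j) # rs) = (0 :: 'a::comm_ring_1)"
proof -
  obtain k where k: "k < length rs" "rs ! k = r" using assms by (auto simp: in_set_conv_nth)
  obtain u where u: "\<And>r. moment_det (r # rs) = (\<Sum>j\<le>length rs. r j * u j)"
    using moment_det_Cons_linear by metis
  have "moment_det (r # rs) = 0"
    unfolding moment_det_def
    by (rule det_identical_rows[of _ "Suc (length rs)" 0 "Suc k"]) (use k in auto)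
  moreover have "moment_det ((\<lambda>j. c * r j) # rs) = c * moment_det (r # rs)"
    unfolding u by (simp add: sum_distrib_left mult.assoc)
  ultimately show ?thesis by simp
qed

text \<open>Subtracting \<open>x\<close> times each column from the next one turns the evaluation
  row into (1, 0, ..., 0) and applies \<open>times_linear x\<close> to the other rows.\<close>

lemma moment_det_Cons_eval_moments:
  fixes rs :: "(nat \<Rightarrow> 'a::comm_ring_1) list"
  shows "moment_det (eval_moments x # rs) = moment_det (map (times_linear x) rs)"
proof -
  define n where "n = length rs"
  let ?R = "eval_moments x # rs"
  define A where "A = mat (Suc n) (Suc n) (\<lambda>(i, j). (?R ! i) j)"
  \<comment> \<open>Right multiplication by this unit upper triangular matrix performs the column
    operations; column 0 has no predecessor and stays as it is.\<close>
  define U where "U = mat (Suc n) (Suc n)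
    (\<lambda>(i, j). (if i = j then 1 else 0) - (if Suc i = j then x else 0))"
  have A: "A \<in> carrier_mat (Suc n) (Suc n)" and U: "U \<in> carrier_mat (Suc n) (Suc n)"
    by (auto simp: A_def U_def)
  have "upper_triangular U" by (auto simp: U_def)
  then have "det U = prod_list (diag_mat U)" using U by (rule det_upper_triangular)
  also have "diag_mat U = replicate (Suc n) 1"
    by (rule nth_equalityI) (auto simp: diag_mat_def U_def simp del: replicate_Suc upt_Suc)
  finally have "det (A * U) = det A" using det_mult[OF A U] by simp
  have AU: "(A * U) $$ (i, j) = (case j of 0 \<Rightarrow> (?R ! i) 0 | Suc k \<Rightarrow> times_linear x (?R ! i) k)"
    if "i < Suc n" "j < Suc n" for i j
  proof -
    have "(A * U) $$ (i, j) = (\<Sum>k<Suc n. (?R ! i) k *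
        ((if k = j then 1 else 0) - (if Suc k = j then x else 0)))"
      using that by (simp add: A_def U_def scalar_prod_def lessThan_atLeast0 del: sum.lessThan_Suc sum.op_ivl_Suc)
    also have "\<dots> = (\<Sum>k<Suc n. if k = j then (?R ! i) k else 0)
        - (\<Sum>k<Suc n. if Suc k = j then (?R ! i) k * x else 0)"
      unfolding sum_subtractf[symmetric] by (rule sum.cong) auto
    also have "(\<Sum>k<Suc n. if k = j then (?R ! i) k else 0) = (?R ! i) j"
      using that by (subst sum.delta) auto
    also have "(\<Sum>k<Suc n. if Suc k = j then (?R ! i) k * x else 0)
        = (case j of 0 \<Rightarrow> 0 | Suc l \<Rightarrow> x * (?R ! i) l)"
    proof (cases j)
      case (Suc l)
      then have "(\<Sum>k<Suc n. if Suc k = j then (?R ! i) k * x else 0)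
          = (\<Sum>k<Suc n. if k = l then (?R ! i) k * x else 0)"
        by (intro sum.cong) auto
      with Suc that show ?thesis by (subst (asm) sum.delta) (auto simp: mult.commute)
    qed simp
    finally show ?thesis by (cases j) (simp_all add: times_linear_def)
  qed
  have "moment_det ?R = det (A * U)"
    using \<open>det (A * U) = det A\<close> by (simp add: moment_det_def A_def n_def)
  also have "\<dots> = (\<Sum>j<Suc n. (A * U) $$ (0, j) * cofactor (A * U) 0 j)"
    by (rule laplace_expansion_row) (use A U in auto)
  also have "\<dots> = (A * U) $$ (0, 0) * cofactor (A * U) 0 0"
  proof -
    have "(\<Sum>j<n. (A * U) $$ (0, Suc j) * cofactor (A * U) 0 (Suc j)) = 0"
      by (rule sum.neutral) (auto simp: AU times_linear_def eval_moments_def)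
    then show ?thesis unfolding sum.lessThan_Suc_shift by simp
  qed
  also have "\<dots> = det (mat_delete (A * U) 0 0)"
    by (simp add: AU eval_moments_def cofactor_def)
  also have "mat_delete (A * U) 0 0 = mat n n (\<lambda>(i, j). (map (times_linear x) rs ! i) j)"
    using A U by (intro eq_matI) (auto simp: mat_delete_def AU n_def simp del: index_mult_mat(1))
  finally show ?thesis by (simp add: moment_det_def n_def)
qed

lemma moment_det_scale_rows:
  fixes rs :: "(nat \<Rightarrow> 'a::comm_ring_1) list"
  assumes "length cs = length rs"
  shows "moment_det (map2 (\<lambda>c r j. c * r j) cs rs) = prod_list cs * moment_det rs"
proof -
  let ?n = "length rs"
  let ?P = "{p. p permutes {0..<?n}}"
  have less: "p i < ?n" if "p \<in> ?P" "i < ?n" for p i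
    using that permutes_in_image[of p "{0..<?n}" i] by auto
  have "moment_det (map2 (\<lambda>c r j. c * r j) cs rs) =
      (\<Sum>p\<in>?P. signof p * (\<Prod>i = 0..<?n. cs ! i * (rs ! i) (p i)))"
    unfolding moment_det_def using assms
    by (subst det_def'[where n = ?n])
      (auto simp: less intro!: sum.cong prod.cong arg_cong2[where f = "(*)"])
  also have "\<dots> = prod_list cs * (\<Sum>p\<in>?P. signof p * (\<Prod>i = 0..<?n. (rs ! i) (p i)))"
    using assms by (simp add: prod.distrib sum_distrib_left prod.list_conv_set_nth mult_ac)
  also have "(\<Sum>p\<in>?P. signof p * (\<Prod>i = 0..<?n. (rs ! i) (p i))) = moment_det rs"
    unfolding moment_det_def
    by (subst det_def'[where n = ?n])
      (auto simp: less intro!: sum.cong prod.cong arg_cong2[where f = "(*)"])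
  finally show ?thesis .
qed

text \<open>The functional \<open>times_linear x\<close> multiplies evaluation at \<open>y\<close>
  by \<open>y - x\<close>, and these scalars come out of the rows. Iteration strips off all
  evaluation rows and builds the Vandermonde factor.\<close>

lemma moment_det_eval_moments_Cons:
  fixes rs :: "(nat \<Rightarrow> 'a::comm_ring_1) list"
  shows "moment_det (map eval_moments (x # xs) @ rs) =
    (\<Prod>y\<leftarrow>xs. y - x) * moment_det (map eval_moments xs @ map (times_linear x) rs)"
proof -
  have e: "times_linear x (eval_moments y) = (\<lambda>j. (y - x) * eval_moments y j)" for y
    by (auto simp: times_linear_def eval_moments_def algebra_simps)
  have "map (times_linear x) (map eval_moments xs @ rs) =
    map2 (\<lambda>c r j. c * r j) (map (\<lambda>y. y - x) xs @ replicate (length rs) 1)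
      (map eval_moments xs @ map (times_linear x) rs)"
    by (rule nth_equalityI) (auto simp: nth_append e)
  then show ?thesis
    by (simp add: moment_det_Cons_eval_moments moment_det_scale_rows del: map_append zip_append)
qed

section \<open>Cramer's rule and the general bilinear expansion\<close>

text \<open>The adjugate gives Cramer's rule without division, so it holds over any commutative ring
  and for singular \<open>A\<close>.\<close>

lemma cramer_det:
  assumes A: "(A :: 'a::comm_ring_1 mat) \<in> carrier_mat n n" and v: "v \<in> carrier_vec n" and k: "k < n"
  shows "det A * v $ k = (\<Sum>i<n. cofactor A i k * (A *\<^sub>v v) $ i)"
proof -
  note adj = adj_mat[OF A]
  have "adj_mat A *\<^sub>v (A *\<^sub>v v) = (det A \<cdot>\<^sub>m 1\<^sub>m n) *\<^sub>v v"
    using assoc_mult_mat_vec[OF adj(1) A v] adj(3) by simp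
  also have "\<dots> = det A \<cdot>\<^sub>v v"
    using v by (intro eq_vecI) (auto simp: smult_scalar_prod_distrib[where n = n])
  finally have "adj_mat A *\<^sub>v (A *\<^sub>v v) = det A \<cdot>\<^sub>v v" .
  then have "det A * v $ k = (adj_mat A *\<^sub>v (A *\<^sub>v v)) $ k"
    using v k by simp
  also have "\<dots> = (\<Sum>i<n. cofactor A i k * (A *\<^sub>v v) $ i)"
    using A k by (auto simp: adj_mat_def scalar_prod_def lessThan_atLeast0 intro!: sum.cong)
  finally show ?thesis .
qed

text \<open>With d points and N rows in \<open>rs\<close>, the product of h and the cofactor
  polynomial has at most d + N coefficients, as many as there are rows. The rows in
  \<open>rs\<close> contribute zero to Cramer's rule for the top coefficient, and the row of each
  point contributes the value of the product there times the minor omitting that point.\<close>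

lemma moment_det_expansion:
  fixes rs :: "(nat \<Rightarrow> 'a::comm_ring_1) list" and h :: "nat \<Rightarrow> 'a"
  assumes xs: "xs \<noteq> []"
    and eigen: "\<And>r. r \<in> set rs \<Longrightarrow> \<exists>c. \<forall>j. (\<Sum>i<length xs. h i * r (i + j)) = c * r j"
  shows "h (length xs - 1) * moment_det rs * moment_det (map eval_moments xs @ rs) =
    (\<Sum>i<length xs. (-1) ^ (i + length xs - 1) * (\<Sum>k<length xs. h k * (xs ! i) ^ k) *
       moment_det (eval_moments (xs ! i) # rs) *
       moment_det (map eval_moments (take i xs @ drop (Suc i) xs) @ rs))"
proof -
  define d N n where "d = length xs" and "N = length rs" and "n = d + N"
  have d: "d > 0" using xs by (simp add: d_def)
  obtain u where u: "\<And>r. moment_det (r # rs) = (\<Sum>j\<le>N. r j * u j)"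
    and uN: "u N = (-1) ^ N * moment_det rs"
    unfolding N_def using moment_det_Cons_linear by metis
  let ?R = "map eval_moments xs @ rs"
  define A where "A = mat n n (\<lambda>(i, j). (?R ! i) j)"
  \<comment> \<open>\<open>u\<close> is the coefficient vector of the polynomial of degree at most \<open>N\<close> which all rows in \<open>rs\<close>
    annihilate (they apply to polynomials in \<open>t\<close> by sending \<open>t^j\<close> to the \<open>j\<close>-th moment), and \<open>v\<close> is that
    of its product with \<open>\<Sum>i. h i * t^i\<close>, which they annihilate too by assumption.\<close>
  define v where "v = vec n (\<lambda>m. \<Sum>i<d. \<Sum>j\<le>N. if m = i + j then h i * u j else 0)"
  have A: "A \<in> carrier_mat n n" and v: "v \<in> carrier_vec n"
    by (auto simp: A_def v_def)
  have "v $ (n - 1) = (\<Sum>i<d. \<Sum>j\<le>N. if n - 1 = i + j then h i * u j else 0)"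
    using d by (simp add: v_def n_def)
  also have "\<dots> = (\<Sum>i<d. \<Sum>j\<le>N. if i = d - 1 then (if j = N then h i * u j else 0) else 0)"
  proof (intro sum.cong refl)
    fix i j assume "i \<in> {..<d}" "j \<in> {..N}"
    \<comment> \<open>The last index is the sum of the two maximal degrees \<open>d - 1\<close> and
      \<open>N\<close>, so only the product of the leading coefficients reaches it.\<close>
    then have "n - 1 = i + j \<longleftrightarrow> i = d - 1 \<and> j = N"
      unfolding n_def lessThan_iff atMost_iff by linarith
    then show "(if n - 1 = i + j then h i * u j else 0) =
        (if i = d - 1 then (if j = N then h i * u j else 0) else 0)" by simp
  qed
  also have "\<dots> = h (d - 1) * u N"
  proof -
    have "(\<Sum>j\<le>N. if i = d - 1 then (if j = N then h i * u j else 0) else 0) =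
        (if i = d - 1 then h i * u N else 0)" for i by auto
    then show ?thesis using d by (simp add: sum.delta')
  qed
  finally have v_last: "v $ (n - 1) = h (d - 1) * u N" .
  \<comment> \<open>Applying a functional to h times u is applying to u the functional composed with
    multiplication by h; by the choice of \<open>u\<close> this is a determinant with one extra
    row.\<close>
  have Av: "(A *\<^sub>v v) $ i = moment_det ((\<lambda>j. \<Sum>k<d. h k * (?R ! i) (k + j)) # rs)" if i: "i < n" for i
  proof -
    have "(A *\<^sub>v v) $ i = (\<Sum>m<n. (?R ! i) m * (\<Sum>k<d. \<Sum>j\<le>N. if m = k + j then h k * u j else 0))"
      using i by (simp add: A_def v_def scalar_prod_def lessThan_atLeast0)
    also have "\<dots> = (\<Sum>m<n. \<Sum>k<d. \<Sum>j\<le>N. if m = k + j then (?R ! i) m * (h k * u j) else 0)"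
      unfolding sum_distrib_left by (intro sum.cong) auto
    also have "\<dots> = (\<Sum>k<d. \<Sum>j\<le>N. \<Sum>m<n. if m = k + j then (?R ! i) m * (h k * u j) else 0)"
      by (subst sum.swap, subst (2) sum.swap) (rule refl)
    also have "\<dots> = (\<Sum>k<d. \<Sum>j\<le>N. (?R ! i) (k + j) * (h k * u j))"
      by (intro sum.cong refl, subst sum.delta) (auto simp: n_def)
    also have "\<dots> = (\<Sum>j\<le>N. \<Sum>k<d. (?R ! i) (k + j) * (h k * u j))"
      by (rule sum.swap)
    also have "\<dots> = moment_det ((\<lambda>j. \<Sum>k<d. h k * (?R ! i) (k + j)) # rs)"
      unfolding u sum_distrib_right by (simp add: mult_ac)
    finally show ?thesis .
  qed
  \<comment> \<open>Evaluation is multiplicative, so the value at a point is that of h times that of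
    u.\<close>
  have Av_eval: "(A *\<^sub>v v) $ i = (\<Sum>k<d. h k * (xs ! i) ^ k) * moment_det (eval_moments (xs ! i) # rs)"
    if i: "i < d" for i
  proof -
    have "i < n" and "?R ! i = eval_moments (xs ! i)"
      using i by (auto simp: n_def d_def nth_append)
    then show ?thesis
      by (simp add: Av u eval_moments_def power_add sum_distrib_left sum_distrib_right mult_ac)
  qed
  have Av_rs: "(A *\<^sub>v v) $ (d + i) = 0" if i: "i < N" for i
  proof -
    have R: "?R ! (d + i) = rs ! i" and "rs ! i \<in> set rs"
      using i by (auto simp: d_def N_def nth_append)
    then obtain c where "\<forall>j. (\<Sum>k<d. h k * (rs ! i) (k + j)) = c * (rs ! i) j"
      using eigen unfolding d_def by blast
    then show ?thesis
      using i \<open>rs ! i \<in> set rs\<close> by (simp add: Av n_def R moment_det_Cons_member)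
  qed
  have minor: "det (mat_delete A i (n - 1)) = moment_det (map eval_moments (take i xs @ drop (Suc i) xs) @ rs)"
    if i: "i < d" for i
  proof -
    have "mat_delete A i (n - 1) =
        mat (n - 1) (n - 1) (\<lambda>(k, j). ((map eval_moments (take i xs @ drop (Suc i) xs) @ rs) ! k) j)"
      using i by (intro eq_matI) (auto simp: mat_delete_def A_def nth_append n_def d_def N_def)
    then show ?thesis using i by (simp add: moment_det_def n_def d_def N_def)
  qed
  have "det A * (h (d - 1) * u N) = (\<Sum>i<d + N. cofactor A i (n - 1) * (A *\<^sub>v v) $ i)"
    using cramer_det[OF A v, of "n - 1"] d unfolding v_last by (simp add: n_def)
  also have "\<dots> = (\<Sum>i<d. cofactor A i (n - 1) * (A *\<^sub>v v) $ i)"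
    by (rule sum.mono_neutral_right)
      (auto simp: Av_rs dest!: le_Suc_ex)
  also have "\<dots> = (\<Sum>i<d. (-1) ^ N * ((-1) ^ (i + d - 1) * (\<Sum>k<d. h k * (xs ! i) ^ k) *
      moment_det (eval_moments (xs ! i) # rs) *
      moment_det (map eval_moments (take i xs @ drop (Suc i) xs) @ rs)))"
  proof (rule sum.cong)
    fix i assume i: "i \<in> {..<d}"
    have "i + (n - 1) = N + (i + d - 1)" using d by (simp add: n_def)
    then have sgn: "(-1 :: 'a) ^ (i + (n - 1)) = (-1) ^ N * (-1) ^ (i + d - 1)"
      by (simp only: power_add)
    from i have "i < d" by simp
    then show "cofactor A i (n - 1) * (A *\<^sub>v v) $ i =
      (-1) ^ N * ((-1) ^ (i + d - 1) * (\<Sum>k<d. h k * (xs ! i) ^ k) *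
      moment_det (eval_moments (xs ! i) # rs) *
      moment_det (map eval_moments (take i xs @ drop (Suc i) xs) @ rs))"
      unfolding cofactor_def sgn by (simp only: minor Av_eval mult_ac)
  qed simp
  finally have "det A * (h (d - 1) * u N) = (-1) ^ N * (\<Sum>i<d. (-1) ^ (i + d - 1) *
      (\<Sum>k<d. h k * (xs ! i) ^ k) * moment_det (eval_moments (xs ! i) # rs) *
      moment_det (map eval_moments (take i xs @ drop (Suc i) xs) @ rs))" (is "_ = _ * ?S")
    by (simp only: sum_distrib_left)
  \<comment> \<open>Both sides are multiplied by \<open>(-1) ^ N\<close>, so that the sign in
    \<open>u N\<close> and the one from the cofactors cancel as squares.\<close>
  then have "(-1) ^ N * ((-1) ^ N * (h (d - 1) * moment_det rs * det A)) = (-1) ^ N * ((-1) ^ N * ?S)"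
    by (simp only: uN mult_ac)
  then have "h (d - 1) * moment_det rs * det A = ?S"
    by (simp flip: power_add mult.assoc power_mult_distrib)
  moreover have "det A = moment_det ?R" by (simp add: A_def moment_det_def n_def d_def N_def)
  ultimately show ?thesis unfolding d_def by simp
qed

section \<open>The three-term and four-term identities\<close>

text \<open>The expansion at three points with h = 1: the coefficient of h at degree 2 is zero, so
  the left side disappears.\<close>

lemma moment_det_three_term:
  fixes rs :: "(nat \<Rightarrow> 'a::comm_ring_1) list"
  defines "D \<equiv> \<lambda>xs. moment_det (foldl (\<lambda>rs x. map (times_linear x) rs) rs xs)"
  shows "(z - y) * D [y, z] * D [x] - (z - x) * D [x, z] * D [y] + (y - x) * D [x, y] * D [z] = 0"
proof -
  have *: "(\<Sum>i<length [x, y, z]. (if i = 0 then 1 else 0) * r (i + j)) = 1 * r j"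
    for r :: "nat \<Rightarrow> 'a" and j by (simp add: lessThan_Suc numeral_3_eq_3)
  have two: "moment_det (eval_moments u # eval_moments v # rs) = (v - u) * D [u, v]" for u v
    using moment_det_eval_moments_Cons[of u "[v]" rs]
      moment_det_Cons_eval_moments[of v "map (times_linear u) rs"]
    by (simp add: D_def)
  have one: "moment_det (eval_moments u # rs) = D [u]" for u
    by (simp add: D_def moment_det_Cons_eval_moments)
  have "\<exists>c. \<forall>j. (\<Sum>i<length [x, y, z]. (if i = 0 then 1 else 0) * r (i + j)) = c * r j"
    for r :: "nat \<Rightarrow> 'a" using * by blast
  then show ?thesis
    using moment_det_expansion[of "[x, y, z]" rs "\<lambda>i. if i = 0 then 1 else 0", OF list.distinct(2)]
    by (simp add: one two eval_nat_numeral algebra_simps)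
qed

text \<open>The expansion at four points with the monic cubic \<open>H\<close>. The left side
  carries the Vandermonde product of all four points, each term on the right that of the three
  points left over.\<close>

lemma moment_det_four_term:
  fixes rs :: "(nat \<Rightarrow> 'a::comm_ring_1) list" and c0 c1 c2 :: 'a
  defines "D \<equiv> \<lambda>xs. moment_det (foldl (\<lambda>rs x. map (times_linear x) rs) rs xs)"
    and "H \<equiv> \<lambda>t. c0 + c1 * t + c2 * t ^ 2 + t ^ 3"
  assumes eigen: "\<And>r. r \<in> set rs \<Longrightarrow>
    \<exists>c. \<forall>j. c0 * r j + c1 * r (j + 1) + c2 * r (j + 2) + r (j + 3) = c * r j"
  shows "(y - x) * (z - x) * (w - x) * (z - y) * (w - y) * (w - z) * D [] * D [x, y, z, w] =
    - H x * (z - y) * (w - y) * (w - z) * D [x] * D [y, z, w]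
    + H y * (z - x) * (w - x) * (w - z) * D [y] * D [x, z, w]
    - H z * (y - x) * (w - x) * (w - y) * D [z] * D [x, y, w]
    + H w * (y - x) * (z - x) * (z - y) * D [w] * D [x, y, z]"
proof -
  define h where "h = (!) [c0, c1, c2, 1]"
  have h: "h 0 = c0" "h (Suc 0) = c1" "h (Suc (Suc 0)) = c2" "h (Suc (Suc (Suc 0))) = 1"
    by (simp_all add: h_def)
  have sum4: "(\<Sum>i<length [x, y, z, w]. g i) = g 0 + g 1 + g 2 + g 3" for g :: "nat \<Rightarrow> 'a"
    by (simp add: eval_nat_numeral)
  have one: "moment_det (eval_moments u # rs) = D [u]" for u
    by (simp add: D_def moment_det_Cons_eval_moments)
  have three: "moment_det (eval_moments t # eval_moments u # eval_moments v # rs) =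
      (u - t) * (v - t) * (v - u) * D [t, u, v]" for t u v
    using moment_det_eval_moments_Cons[of t "[u, v]" rs]
      moment_det_eval_moments_Cons[of u "[v]" "map (times_linear t) rs"]
      moment_det_Cons_eval_moments[of v "map (times_linear u) (map (times_linear t) rs)"]
    by (simp add: D_def mult_ac del: map_map)
  have four: "moment_det (eval_moments x # eval_moments y # eval_moments z # eval_moments w # rs) =
      (y - x) * (z - x) * (w - x) * (z - y) * (w - y) * (w - z) * D [x, y, z, w]"
    using moment_det_eval_moments_Cons[of x "[y, z, w]" rs]
      moment_det_eval_moments_Cons[of y "[z, w]" "map (times_linear x) rs"]
      moment_det_eval_moments_Cons[of z "[w]" "map (times_linear y) (map (times_linear x) rs)"]
      moment_det_Cons_eval_moments[of w "map (times_linear z) (map (times_linear y) (map (times_linear x) rs))"]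
    by (simp add: D_def mult_ac del: map_map)
  have H: "(\<Sum>i<length [x, y, z, w]. h i * t ^ i) = H t" for t
    unfolding sum4 by (simp add: h H_def eval_nat_numeral)
  have "\<exists>c. \<forall>j. (\<Sum>i<length [x, y, z, w]. h i * r (i + j)) = c * r j" if "r \<in> set rs" for r
    using eigen[OF that] unfolding sum4 by (simp add: h eval_nat_numeral add.commute)
  then have "h (length [x, y, z, w] - 1) * moment_det rs *
      moment_det (map eval_moments [x, y, z, w] @ rs) = 
    (\<Sum>i<length [x, y, z, w]. (- 1) ^ (i + length [x, y, z, w] - 1) * H ([x, y, z, w] ! i) *
      moment_det (eval_moments ([x, y, z, w] ! i) # rs) *
      moment_det (map eval_moments (take i [x, y, z, w] @ drop (Suc i) [x, y, z, w]) @ rs))"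
    unfolding H[symmetric] by (intro moment_det_expansion) auto
  moreover have "moment_det rs = D []" by (simp add: D_def)
  ultimately show ?thesis
    unfolding sum4 by (simp add: h one three four eval_nat_numeral mult_ac)
qed

section \<open>From the bilinear equations to the lattice system\<close>

text \<open>The third bilinear equation turns the denominator into a product of nonzero factors.
  After that, the left sides of the lattice equations are explicit multiples of those of the first,
  second and fourth bilinear equations.\<close>

lemma C3_system_of_bilinear_C3:
  fixes f :: "int \<Rightarrow> int \<Rightarrow> int \<Rightarrow> int \<Rightarrow> complex"
  assumes dist: "distinct [p, q, a, b]" and bil: "bilinear_C3 \<alpha>\<^sub>2 p q a b f"
    and nz: "\<And>n m \<alpha> \<beta>. f n m \<alpha> \<beta> \<noteq> 0"
  shows "C3_system (cub \<alpha>\<^sub>2 p a) (cub \<alpha>\<^sub>2 q a) (cub \<alpha>\<^sub>2 a b)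
              (\<lambda>n m. x_ab p q a b n m * (f n m (\<alpha>-1) (\<beta>+1) / f n m \<alpha> \<beta>))
              (\<lambda>n m. y_a p q a n m * (f n m (\<alpha>-1) \<beta> / f n m \<alpha> \<beta>))
              (\<lambda>n m. z_b p q b n m * (f n m \<alpha> (\<beta>+1) / f n m \<alpha> \<beta>))"
  unfolding C3_system_def
proof (intro allI)
  fix n m :: int
  have ne: "p - a \<noteq> 0" "q - a \<noteq> 0" "p - b \<noteq> 0" "q - b \<noteq> 0" "p - q \<noteq> 0" "b - a \<noteq> 0"
    using dist by auto
  define X Y Z where "X = x_ab p q a b n m" and "Y = y_a p q a n m" and "Z = z_b p q b n m"
  have Z0: "Z \<noteq> 0" and Y0: "Y \<noteq> 0"
    using ne by (auto simp: Z_def z_b_def Y_def y_a_def)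
  \<comment> \<open>This relation lets a common factor \<open>Y * Z\<close> be taken out of each
    lattice equation.\<close>
  have X: "X = - Y * Z / (b - a)"
    using ne by (simp add: X_def Y_def Z_def x_ab_def y_a_def z_b_def power_int_divide_distrib
        power_int_minus field_simps)
  have shifts: "z_b p q b (n+1) m = (p - b) * Z" "z_b p q b n (m+1) = (q - b) * Z"
    "z_b p q b (n+1) (m+1) = (p - b) * (q - b) * Z"
    "y_a p q a (n+1) m = Y / (p - a)" "y_a p q a n (m+1) = Y / (q - a)"
    "x_ab p q a b (n+1) m = (p - b) / (p - a) * X" "x_ab p q a b n (m+1) = (q - b) / (q - a) * X"
    using ne power_int_diff[of "p - a" "- n" 1] power_int_diff[of "q - a" "- m" 1]
    by (simp_all add: X_def Y_def Z_def x_ab_def y_a_def z_b_def power_int_add mult_ac)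
  \<comment> \<open>The letters \<open>f\<close>, \<open>u\<close>, \<open>b\<close>,
    \<open>v\<close> stand for no shift, underline, bullet, and both; the suffixes \<open>n\<close>
    and \<open>m\<close> mark tilde and hat. In particular \<open>b0\<close> is a value of
    \<open>f\<close>, not the constant of the lattice system.\<close>
  define f0 fn fm fnm where "f0 = f n m \<alpha> \<beta>" and "fn = f (n+1) m \<alpha> \<beta>"
    and "fm = f n (m+1) \<alpha> \<beta>" and "fnm = f (n+1) (m+1) \<alpha> \<beta>"
  define u0 un um where "u0 = f n m (\<alpha>-1) \<beta>" and "un = f (n+1) m (\<alpha>-1) \<beta>"
    and "um = f n (m+1) (\<alpha>-1) \<beta>"
  define b0 bn bm bnm where "b0 = f n m \<alpha> (\<beta>+1)" and "bn = f (n+1) m \<alpha> (\<beta>+1)"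
    and "bm = f n (m+1) \<alpha> (\<beta>+1)" and "bnm = f (n+1) (m+1) \<alpha> (\<beta>+1)"
  define v0 vn vm where "v0 = f n m (\<alpha>-1) (\<beta>+1)" and "vn = f (n+1) m (\<alpha>-1) (\<beta>+1)"
    and "vm = f n (m+1) (\<alpha>-1) (\<beta>+1)"
  note defs = f0_def fn_def fm_def fnm_def u0_def un_def um_def b0_def bn_def bm_def bnm_def
    v0_def vn_def vm_def
  have f_ne: "f0 \<noteq> 0" "fn \<noteq> 0" "fm \<noteq> 0" "fnm \<noteq> 0" "b0 \<noteq> 0"
    by (simp_all add: defs nz)
  have e1: "(p - b) * vn * f0 - (p - a) * v0 * fn + (b - a) * b0 * un = 0"
    and e2: "(q - b) * vm * f0 - (q - a) * v0 * fm + (b - a) * b0 * um = 0"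
    and e3: "(p - b) * fm * bn - (q - b) * fn * bm - (p - q) * fnm * b0 = 0"
    and e4: "(p - q) * bnm * u0 - (p - q) * a_b \<alpha>\<^sub>2 a b / ((p - b) * (q - b)) * fnm * v0
      - cub_quot \<alpha>\<^sub>2 p a / (p - b) * bm * un + cub_quot \<alpha>\<^sub>2 q a / (q - b) * bn * um = 0"
    using bil unfolding bilinear_C3_def defs by blast+
  have denom: "(p - b) * Z * (bn / fn) - (q - b) * Z * (bm / fm) = Z * (p - q) * fnm * b0 / (fn * fm)"
  proof -
    have "(p - b) * Z * (bn / fn) - (q - b) * Z * (bm / fm) =
        Z * ((p - b) * fm * bn - (q - b) * fn * bm) / (fn * fm)"
      using f_ne by (simp add: field_simps)
    also have "(p - b) * fm * bn - (q - b) * fn * bm = (p - q) * fnm * b0"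
      using e3 by simp
    finally show ?thesis by (simp add: mult.assoc)
  qed
  have "(p - b) * Z * (bn / fn) - (q - b) * Z * (bm / fm) \<noteq> 0"
    unfolding denom using Z0 ne f_ne by simp
  moreover have "(p - b) / (p - a) * X * (vn / fn) - Y / (p - a) * (un / fn) * (Z * (b0 / f0))
      - X * (v0 / f0) = - Y * Z / ((p - a) * (b - a) * fn * f0)
        * ((p - b) * vn * f0 - (p - a) * v0 * fn + (b - a) * b0 * un)"
    unfolding X using ne f_ne by (simp add: divide_simps) (simp add: algebra_simps)
  moreover have "(q - b) / (q - a) * X * (vm / fm) - Y / (q - a) * (um / fm) * (Z * (b0 / f0))
      - X * (v0 / f0) = - Y * Z / ((q - a) * (b - a) * fm * f0)
        * ((q - b) * vm * f0 - (q - a) * v0 * fm + (b - a) * b0 * um)"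
    unfolding X using ne f_ne by (simp add: divide_simps) (simp add: algebra_simps)
  moreover have "(p - b) * (q - b) * Z * (bnm / fnm) * (Y * (u0 / f0)) - cub \<alpha>\<^sub>2 a b * (X * (v0 / f0))
      - Z * (b0 / f0) * ((cub \<alpha>\<^sub>2 p a * (Y / (p - a) * (un / fn)) * ((q - b) * Z * (bm / fm))
          - cub \<alpha>\<^sub>2 q a * (Y / (q - a) * (um / fm)) * ((p - b) * Z * (bn / fn)))
        / (Z * (p - q) * fnm * b0 / (fn * fm)))
      = Y * Z * (p - b) * (q - b) / ((p - q) * f0 * fnm) *
        ((p - q) * bnm * u0 - (p - q) * a_b \<alpha>\<^sub>2 a b / ((p - b) * (q - b)) * fnm * v0
         - cub_quot \<alpha>\<^sub>2 p a / (p - b) * bm * un + cub_quot \<alpha>\<^sub>2 q a / (q - b) * bn * um)"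
  proof -
    have c: "cub \<alpha>\<^sub>2 a b = - a_b \<alpha>\<^sub>2 a b * (b - a)"
      by (simp add: cub_def a_b_def algebra_simps power2_eq_square power3_eq_cube)
    show ?thesis
      unfolding X c cub_quot_def using ne f_ne Z0 by (simp add: divide_simps) (simp add: algebra_simps)
  qed
  ultimately show "z_b p q b (n+1) m * (f (n+1) m \<alpha> (\<beta>+1) / f (n+1) m \<alpha> \<beta>)
        - z_b p q b n (m+1) * (f n (m+1) \<alpha> (\<beta>+1) / f n (m+1) \<alpha> \<beta>) \<noteq> 0 \<and>
      x_ab p q a b (n+1) m * (f (n+1) m (\<alpha>-1) (\<beta>+1) / f (n+1) m \<alpha> \<beta>)
        - y_a p q a (n+1) m * (f (n+1) m (\<alpha>-1) \<beta> / f (n+1) m \<alpha> \<beta>) *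
          (z_b p q b n m * (f n m \<alpha> (\<beta>+1) / f n m \<alpha> \<beta>))
        - x_ab p q a b n m * (f n m (\<alpha>-1) (\<beta>+1) / f n m \<alpha> \<beta>) = 0 \<and>
      x_ab p q a b n (m+1) * (f n (m+1) (\<alpha>-1) (\<beta>+1) / f n (m+1) \<alpha> \<beta>)
        - y_a p q a n (m+1) * (f n (m+1) (\<alpha>-1) \<beta> / f n (m+1) \<alpha> \<beta>) *
          (z_b p q b n m * (f n m \<alpha> (\<beta>+1) / f n m \<alpha> \<beta>))
        - x_ab p q a b n m * (f n m (\<alpha>-1) (\<beta>+1) / f n m \<alpha> \<beta>) = 0 \<and>
      z_b p q b (n+1) (m+1) * (f (n+1) (m+1) \<alpha> (\<beta>+1) / f (n+1) (m+1) \<alpha> \<beta>) *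
          (y_a p q a n m * (f n m (\<alpha>-1) \<beta> / f n m \<alpha> \<beta>))
        - cub \<alpha>\<^sub>2 a b * (x_ab p q a b n m * (f n m (\<alpha>-1) (\<beta>+1) / f n m \<alpha> \<beta>))
        - z_b p q b n m * (f n m \<alpha> (\<beta>+1) / f n m \<alpha> \<beta>) *
          ((cub \<alpha>\<^sub>2 p a * (y_a p q a (n+1) m * (f (n+1) m (\<alpha>-1) \<beta> / f (n+1) m \<alpha> \<beta>)) *
              (z_b p q b n (m+1) * (f n (m+1) \<alpha> (\<beta>+1) / f n (m+1) \<alpha> \<beta>))
            - cub \<alpha>\<^sub>2 q a * (y_a p q a n (m+1) * (f n (m+1) (\<alpha>-1) \<beta> / f n (m+1) \<alpha> \<beta>)) *
              (z_b p q b (n+1) m * (f (n+1) m \<alpha> (\<beta>+1) / f (n+1) m \<alpha> \<beta>)))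
           / (z_b p q b (n+1) m * (f (n+1) m \<alpha> (\<beta>+1) / f (n+1) m \<alpha> \<beta>)
              - z_b p q b n (m+1) * (f n (m+1) \<alpha> (\<beta>+1) / f n (m+1) \<alpha> \<beta>))) = 0"
    unfolding shifts X_def[symmetric] Y_def[symmetric] Z_def[symmetric] defs[symmetric] denom e1 e2 e4
    by simp
qed

section \<open>Casoratian solutions of the bilinear equations\<close>

lemma bilinear_C3_casoratian:
  assumes dist: "distinct [p, q, a, b]" and root: "root_triple \<alpha>\<^sub>2 \<omega>"
    and ne: "\<And>j s. j < N \<Longrightarrow> s \<le> 2 \<Longrightarrow>
      p \<noteq> \<omega> s (k j) \<and> q \<noteq> \<omega> s (k j) \<and> a \<noteq> \<omega> s (k j) \<and> b \<noteq> \<omega> s (k j)"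
  shows "bilinear_C3 \<alpha>\<^sub>2 p q a b
    (\<lambda>n m \<alpha> \<beta>. casoratian (psi_vec p q a b \<omega> N \<delta> k \<rho> n m \<alpha> \<beta>) [0..<N])"
proof -
  define \<psi> where "\<psi> n m \<alpha> \<beta> j l = psi_vec p q a b \<omega> N \<delta> k \<rho> n m \<alpha> \<beta> l $ j" for n m \<alpha> \<beta> j l
  \<comment> \<open>The matrix is read by rows: for fixed \<open>j\<close>, the entries as a
    function of \<open>l\<close> are the moments of one functional.\<close>
  define rs where "rs n m \<alpha> \<beta> = map (\<psi> n m \<alpha> \<beta>) [0..<N]" for n m \<alpha> \<beta>
  have f: "casoratian (psi_vec p q a b \<omega> N \<delta> k \<rho> n m \<alpha> \<beta>) [0..<N] = moment_det (rs n m \<alpha> \<beta>)"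
    for n m \<alpha> \<beta>
    unfolding casoratian_def moment_det_def rs_def
    by (rule arg_cong[where f = det], rule eq_matI) (auto simp: mat_of_cols_def \<psi>_def)
  \<comment> \<open>With \<open>t = \<delta> - \<omega>\<close> the moments are the Casoratian entries, and \<open>p - \<omega> = t - (\<delta> - p)\<close>.\<close>
  have shift: "map (times_linear (\<delta> - p)) (rs n m \<alpha> \<beta>) = rs (n+1) m \<alpha> \<beta>"
    "map (times_linear (\<delta> - q)) (rs n m \<alpha> \<beta>) = rs n (m+1) \<alpha> \<beta>"
    "map (times_linear (\<delta> - a)) (rs n m \<alpha> \<beta>) = rs n m (\<alpha>+1) \<beta>"
    "map (times_linear (\<delta> - b)) (rs n m \<alpha> \<beta>) = rs n m \<alpha> (\<beta>+1)" for n m \<alpha> \<beta>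
    \<comment> \<open>The bases of \<open>powi\<close> are nonzero by \<open>ne\<close>, so raising
      an integer exponent by one multiplies by the base even for negative exponents.\<close>
    using ne
    by (auto simp: rs_def \<psi>_def psi_vec_def times_linear_def fun_eq_iff sum_distrib_left
        power_int_add algebra_simps sum_subtractf[symmetric] intro!: sum.cong)
  have cubic: "\<omega> s (k j) ^ 3 - \<alpha>\<^sub>2 * \<omega> s (k j) ^ 2 = k j ^ 3 - \<alpha>\<^sub>2 * k j ^ 2" if "s \<le> 2" for s j
  proof -
    have "\<omega> s (k j) \<in># proots [: - (k j ^ 3 - \<alpha>\<^sub>2 * k j ^ 2), 0, - \<alpha>\<^sub>2, 1 :]"
      using root that unfolding root_triple_def by (auto simp: le_Suc_eq numeral_2_eq_2)
    then have "poly [: - (k j ^ 3 - \<alpha>\<^sub>2 * k j ^ 2), 0, - \<alpha>\<^sub>2, 1 :] (\<omega> s (k j)) = 0"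
      by simp
    then show ?thesis by (simp add: algebra_simps power2_eq_square power3_eq_cube)
  qed
  \<comment> \<open>The coefficients of the cubic \<open>(a^3 - \<alpha>\<^sub>2 a^2) - (\<omega>^3 - \<alpha>\<^sub>2 \<omega>^2)\<close> in \<open>t = \<delta> - \<omega>\<close>; it has the
    same value at the three roots \<open>\<omega>\<close>, so multiplication by it only rescales each row.\<close>
  define c0 c1 c2 where "c0 = a ^ 3 - \<alpha>\<^sub>2 * a ^ 2 - \<delta> ^ 3 + \<alpha>\<^sub>2 * \<delta> ^ 2"
    and "c1 = 3 * \<delta> ^ 2 - 2 * \<alpha>\<^sub>2 * \<delta>" and "c2 = \<alpha>\<^sub>2 - 3 * \<delta>"
  have H: "c0 + c1 * (\<delta> - x) + c2 * (\<delta> - x) ^ 2 + (\<delta> - x) ^ 3 = - cub \<alpha>\<^sub>2 x a" for x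
    by (simp add: c0_def c1_def c2_def cub_def algebra_simps power2_eq_square power3_eq_cube)
  have eigen: "\<exists>c. \<forall>l. c0 * r l + c1 * r (l + 1) + c2 * r (l + 2) + r (l + 3) = c * r l"
    if "r \<in> set (rs n m \<alpha> \<beta>)" for r n m \<alpha> \<beta>
  proof -
    note r_in = that
    obtain j where j: "j < N" "r = \<psi> n m \<alpha> \<beta> j" using r_in by (auto simp: rs_def)
    \<comment> \<open>The row is a combination of evaluations at the three points
      \<open>\<delta> - \<omega> s (k j)\<close> with these weights.\<close>
    define w where "w s = (p - \<omega> s (k j)) powi n * (q - \<omega> s (k j)) powi m
       * (a - \<omega> s (k j)) powi \<alpha> * (b - \<omega> s (k j)) powi \<beta> * \<rho> j s" for s
    have r: "r l = (\<Sum>s = 0..2. (\<delta> - \<omega> s (k j)) ^ l * w s)" for l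
      using j by (simp add: \<psi>_def psi_vec_def w_def mult.assoc)
    have "c0 * r l + c1 * r (l + 1) + c2 * r (l + 2) + r (l + 3) = - cub \<alpha>\<^sub>2 (k j) a * r l" for l
    proof -
      have "c0 * r l + c1 * r (l + 1) + c2 * r (l + 2) + r (l + 3) =
          (\<Sum>s = 0..2. (c0 + c1 * (\<delta> - \<omega> s (k j)) + c2 * (\<delta> - \<omega> s (k j)) ^ 2 + (\<delta> - \<omega> s (k j)) ^ 3)
            * ((\<delta> - \<omega> s (k j)) ^ l * w s))"
        unfolding r sum_distrib_left sum.distrib[symmetric]
        by (intro sum.cong refl) (simp only: power_add power_one_right distrib_left distrib_right mult_ac)
      also have "\<dots> = - cub \<alpha>\<^sub>2 (k j) a * r l"
        unfolding H r sum_distrib_left using cubic by (intro sum.cong) (auto simp: cub_def)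
      finally show ?thesis .
    qed
    then show ?thesis by blast
  qed
  have d: "p - q \<noteq> 0" "p - a \<noteq> 0" "p - b \<noteq> 0" "q - a \<noteq> 0" "q - b \<noteq> 0" "b - a \<noteq> 0"
    using dist by auto
  \<comment> \<open>The four-term identity is the last bilinear equation multiplied by
    \<open>(p - a) * (q - a) * (p - b) * (q - b) * (b - a)\<close>, which is nonzero;
    \<open>a_b\<close> arises as the quotient of \<open>cub\<close> at \<open>b\<close>,
    \<open>a\<close> by \<open>b - a\<close>.\<close>
  have clear_denominators: "(p - q) * X * U - (p - q) * a_b \<alpha>\<^sub>2 a b / ((p - b) * (q - b)) * X' * V
      - cub_quot \<alpha>\<^sub>2 p a / (p - b) * Y * S + cub_quot \<alpha>\<^sub>2 q a / (q - b) * Y' * T = 0"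
    if "(p - q) * (p - b) * (p - a) * (q - b) * (q - a) * (b - a) * U * X =
      cub \<alpha>\<^sub>2 p a * (q - b) * (q - a) * (b - a) * S * Y
      - cub \<alpha>\<^sub>2 q a * (p - b) * (p - a) * (b - a) * T * Y'
      + cub \<alpha>\<^sub>2 b a * (p - q) * (p - a) * (q - a) * V * X'" for X U X' V Y S Y' T :: complex
  proof -
    have ab: "cub \<alpha>\<^sub>2 b a = a_b \<alpha>\<^sub>2 a b * (b - a)"
      by (simp add: cub_def a_b_def algebra_simps power2_eq_square power3_eq_cube)
    have "(b - a) * ((p - q) * X * U * ((p - b) * (q - b) * (p - a) * (q - a))
        - (p - q) * a_b \<alpha>\<^sub>2 a b * X' * V * ((p - a) * (q - a))
        - cub \<alpha>\<^sub>2 p a * Y * S * ((q - b) * (q - a))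
        + cub \<alpha>\<^sub>2 q a * Y' * T * ((p - a) * (p - b))) =
      (p - q) * (p - b) * (p - a) * (q - b) * (q - a) * (b - a) * U * X -
      (cub \<alpha>\<^sub>2 p a * (q - b) * (q - a) * (b - a) * S * Y
      - cub \<alpha>\<^sub>2 q a * (p - b) * (p - a) * (b - a) * T * Y'
      + a_b \<alpha>\<^sub>2 a b * (b - a) * (p - q) * (p - a) * (q - a) * V * X')"
      by (simp only: left_diff_distrib right_diff_distrib distrib_left distrib_right mult_ac) simp
    also have "\<dots> = 0" using that unfolding ab by simp
    finally have "(b - a) * ((p - q) * X * U * ((p - b) * (q - b) * (p - a) * (q - a))
        - (p - q) * a_b \<alpha>\<^sub>2 a b * X' * V * ((p - a) * (q - a))
        - cub \<alpha>\<^sub>2 p a * Y * S * ((q - b) * (q - a))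
        + cub \<alpha>\<^sub>2 q a * Y' * T * ((p - a) * (p - b))) = 0" .
    then have "(p - q) * X * U * ((p - b) * (q - b) * (p - a) * (q - a))
        - (p - q) * a_b \<alpha>\<^sub>2 a b * X' * V * ((p - a) * (q - a))
        - cub \<alpha>\<^sub>2 p a * Y * S * ((q - b) * (q - a))
        + cub \<alpha>\<^sub>2 q a * Y' * T * ((p - a) * (p - b)) = 0"
      using d by simp
    then show ?thesis
      using d unfolding cub_quot_def by (simp add: divide_simps) (simp add: algebra_simps)
  qed
  show ?thesis
    unfolding bilinear_C3_def f
  proof (intro allI conjI)
    fix n m \<alpha> \<beta> :: int
    show "(p - b) * moment_det (rs (n+1) m (\<alpha>-1) (\<beta>+1)) * moment_det (rs n m \<alpha> \<beta>)
      - (p - a) * moment_det (rs n m (\<alpha>-1) (\<beta>+1)) * moment_det (rs (n+1) m \<alpha> \<beta>)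
      + (b - a) * moment_det (rs n m \<alpha> (\<beta>+1)) * moment_det (rs (n+1) m (\<alpha>-1) \<beta>) = 0"
      \<comment> \<open>Based at \<alpha> - 1, every shift is forward: the shift by \<open>a\<close>
        undoes the underline.\<close>
      using moment_det_three_term[of "\<delta> - b" "\<delta> - p" "rs n m (\<alpha>-1) \<beta>" "\<delta> - a"]
      by (simp add: shift algebra_simps del: map_map)
    show "(q - b) * moment_det (rs n (m+1) (\<alpha>-1) (\<beta>+1)) * moment_det (rs n m \<alpha> \<beta>)
      - (q - a) * moment_det (rs n m (\<alpha>-1) (\<beta>+1)) * moment_det (rs n (m+1) \<alpha> \<beta>)
      + (b - a) * moment_det (rs n m \<alpha> (\<beta>+1)) * moment_det (rs n (m+1) (\<alpha>-1) \<beta>) = 0"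
      using moment_det_three_term[of "\<delta> - b" "\<delta> - q" "rs n m (\<alpha>-1) \<beta>" "\<delta> - a"]
      by (simp add: shift algebra_simps del: map_map)
    show "(p - b) * moment_det (rs n (m+1) \<alpha> \<beta>) * moment_det (rs (n+1) m \<alpha> (\<beta>+1))
      - (q - b) * moment_det (rs (n+1) m \<alpha> \<beta>) * moment_det (rs n (m+1) \<alpha> (\<beta>+1))
      - (p - q) * moment_det (rs (n+1) (m+1) \<alpha> \<beta>) * moment_det (rs n m \<alpha> (\<beta>+1)) = 0"
      \<comment> \<open>No underline occurs here, so the base is \<alpha> and the point for
        \<open>a\<close> is replaced by the one for \<open>q\<close>.\<close>
      using moment_det_three_term[of "\<delta> - b" "\<delta> - p" "rs n m \<alpha> \<beta>" "\<delta> - q"]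
      by (simp add: shift algebra_simps del: map_map)
    have "(p - q) * (p - b) * (p - a) * (q - b) * (q - a) * (b - a)
        * moment_det (rs n m (\<alpha>-1) \<beta>) * moment_det (rs (n+1) (m+1) \<alpha> (\<beta>+1)) =
      cub \<alpha>\<^sub>2 p a * (q - b) * (q - a) * (b - a)
        * moment_det (rs (n+1) m (\<alpha>-1) \<beta>) * moment_det (rs n (m+1) \<alpha> (\<beta>+1))
      - cub \<alpha>\<^sub>2 q a * (p - b) * (p - a) * (b - a)
        * moment_det (rs n (m+1) (\<alpha>-1) \<beta>) * moment_det (rs (n+1) m \<alpha> (\<beta>+1))
      + cub \<alpha>\<^sub>2 b a * (p - q) * (p - a) * (q - a)
        * moment_det (rs n m (\<alpha>-1) (\<beta>+1)) * moment_det (rs (n+1) (m+1) \<alpha> \<beta>)"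
      \<comment> \<open>The points \<open>x\<close>, \<open>y\<close>, \<open>z\<close>,
        \<open>w\<close> of the identity belong to \<open>p\<close>, \<open>q\<close>,
        \<open>b\<close>, \<open>a\<close> in this order. The cubic vanishes at the last one, which
        leaves three terms on the right.\<close>
      using moment_det_four_term[of "rs n m (\<alpha>-1) \<beta>" c0 c1 c2 "\<delta> - q" "\<delta> - p" "\<delta> - b" "\<delta> - a",
        OF eigen] unfolding H
      by (simp add: shift cub_def[of _ a a] del: map_map)
    then show "(p - q) * moment_det (rs (n+1) (m+1) \<alpha> (\<beta>+1)) * moment_det (rs n m (\<alpha>-1) \<beta>)
      - (p - q) * a_b \<alpha>\<^sub>2 a b / ((p - b) * (q - b))
        * moment_det (rs (n+1) (m+1) \<alpha> \<beta>) * moment_det (rs n m (\<alpha>-1) (\<beta>+1))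
      - cub_quot \<alpha>\<^sub>2 p a / (p - b)
        * moment_det (rs n (m+1) \<alpha> (\<beta>+1)) * moment_det (rs (n+1) m (\<alpha>-1) \<beta>)
      + cub_quot \<alpha>\<^sub>2 q a / (q - b)
        * moment_det (rs (n+1) m \<alpha> (\<beta>+1)) * moment_det (rs n (m+1) (\<alpha>-1) \<beta>) = 0"
      by (rule clear_denominators)
  qed
qed

theorem mainTheorem16:
  fixes \<alpha>\<^sub>2 p q a b :: complex
  assumes "distinct [p, q, a, b]"
  shows "(\<forall>f :: int \<Rightarrow> int \<Rightarrow> int \<Rightarrow> int \<Rightarrow> complex.
            bilinear_C3 \<alpha>\<^sub>2 p q a b f \<and> (\<forall>n m \<alpha> \<beta>. f n m \<alpha> \<beta> \<noteq> 0) \<longrightarrow>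
            (\<forall>\<alpha> \<beta>. C3_system (cub \<alpha>\<^sub>2 p a) (cub \<alpha>\<^sub>2 q a) (cub \<alpha>\<^sub>2 a b)
              (\<lambda>n m. x_ab p q a b n m * (f n m (\<alpha>-1) (\<beta>+1) / f n m \<alpha> \<beta>))
              (\<lambda>n m. y_a p q a n m * (f n m (\<alpha>-1) \<beta> / f n m \<alpha> \<beta>))
              (\<lambda>n m. z_b p q b n m * (f n m \<alpha> (\<beta>+1) / f n m \<alpha> \<beta>))))
       \<and> (\<forall>(N :: nat) (\<delta> :: complex) (k :: nat \<Rightarrow> complex) (\<rho> :: nat \<Rightarrow> nat \<Rightarrow> complex)
            (\<omega> :: nat \<Rightarrow> complex \<Rightarrow> complex).
            N \<ge> 1 \<and> root_triple \<alpha>\<^sub>2 \<omega> \<and>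
            (\<forall>j<N. \<forall>s\<in>{0..2}. p \<noteq> \<omega> s (k j) \<and> q \<noteq> \<omega> s (k j) \<and> a \<noteq> \<omega> s (k j) \<and> b \<noteq> \<omega> s (k j)) \<longrightarrow>
            bilinear_C3 \<alpha>\<^sub>2 p q a b
              (\<lambda>n m \<alpha> \<beta>. casoratian (psi_vec p q a b \<omega> N \<delta> k \<rho> n m \<alpha> \<beta>) [0..<N]))"
proof (intro conjI allI impI)
  fix f :: "int \<Rightarrow> int \<Rightarrow> int \<Rightarrow> int \<Rightarrow> complex" and \<alpha> \<beta> :: int
  assume "bilinear_C3 \<alpha>\<^sub>2 p q a b f \<and> (\<forall>n m \<alpha> \<beta>. f n m \<alpha> \<beta> \<noteq> 0)"
  then show "C3_system (cub \<alpha>\<^sub>2 p a) (cub \<alpha>\<^sub>2 q a) (cub \<alpha>\<^sub>2 a b)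
              (\<lambda>n m. x_ab p q a b n m * (f n m (\<alpha>-1) (\<beta>+1) / f n m \<alpha> \<beta>))
              (\<lambda>n m. y_a p q a n m * (f n m (\<alpha>-1) \<beta> / f n m \<alpha> \<beta>))
              (\<lambda>n m. z_b p q b n m * (f n m \<alpha> (\<beta>+1) / f n m \<alpha> \<beta>))"
    using assms by (intro C3_system_of_bilinear_C3) auto
qed (use assms in \<open>intro bilinear_C3_casoratian; simp\<close>)

end
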